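(* The Tomihisa identity holds in every real Lie algebra of dimension 3: if $\mathfrak{g}$ is a real Lie algebra of dimension 3 with bracket $\{\cdot,\cdot\}$, then for all $F_1,F_2,F_3,F_4,F_5\in\mathfrak{g}$, $$\{F_1,\{\{F_2,F_3\},\{F_4,F_5\}\}\}+\{F_3,\{\{F_2,F_5\},\{F_4,F_1\}\}\}+\{F_5,\{\{F_2,F_1\},\{F_4,F_3\}\}\}=0.$$ Hence it holds in the Poisson algebras $\mathcal{S}_1$, $\mathcal{H}_1^-$, $\mathcal{H}_1^+$ and $\mathcal{Q}$.
   Context: $\mathcal{S}_1$ is the span of $\sin\theta\cos\phi,\ \sin\theta\sin\phi,\ \cos\theta$ with bracket $\frac{1}{\sin\theta}(F_\theta F'_\phi-F_\phi F'_\theta)$; $\mathcal{H}_1^-$ is the span of $\sinh\chi\cos\phi,\ \sinh\chi\sin\phi,\ \cosh\chi$ with bracket $\frac{1}{\sinh\chi}(F_\chi F'_\phi-F_\phi F'_\chi)$; $\mathcal{H}_1^+$ is the span of $\cosh\chi\cos\phi,\ \cosh\chi\sin\phi,\ \sinh\chi$ with bracket $\frac{1}{\cosh\chi}(F_\chi F'_\phi-F_\phi F'_\chi)$; $\mathcal{Q}$ is the space of real binary quadratic forms in $(p,q)$ with bracket $F_pF'_q-F_qF'_p$. Subscripts denote partial derivatives; all spans are over $\mathbb{R}$. *)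

theory Defs
  imports "HOL-Analysis.Analysis" "HOL-Library.Function_Algebras"
begin

text \<open>Pointwise real vector space structure on functions; the additive part is in
  \<^theory>\<open>HOL-Library.Function_Algebras\<close>.\<close>

instantiation "fun" :: (type, scaleR) scaleR
begin

definition scaleR_fun_def: "r *\<^sub>R f = (\<lambda>x. r *\<^sub>R f x)"

instance ..

end

instance "fun" :: (type, real_vector) real_vector
  by standard (simp_all add: scaleR_fun_def plus_fun_def fun_eq_iff
      scaleR_add_right scaleR_add_left)

locale real_lie_algebra =
  fixes g :: "'a::real_vector set"
    and br :: "'a \<Rightarrow> 'a \<Rightarrow> 'a"
  assumes subspace: "subspace g"
    and closed: "\<lbrakk>x \<in> g; y \<in> g\<rbrakk> \<Longrightarrow> br x y \<in> g"
    and linear_left: "\<lbrakk>x \<in> g; y \<in> g; z \<in> g\<rbrakk> \<Longrightarrow>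
      br (a *\<^sub>R x + b *\<^sub>R y) z = a *\<^sub>R br x z + b *\<^sub>R br y z"
    and linear_right: "\<lbrakk>x \<in> g; y \<in> g; z \<in> g\<rbrakk> \<Longrightarrow>
      br z (a *\<^sub>R x + b *\<^sub>R y) = a *\<^sub>R br z x + b *\<^sub>R br z y"
    and alternating: "x \<in> g \<Longrightarrow> br x x = 0"
    and jacobi: "\<lbrakk>x \<in> g; y \<in> g; z \<in> g\<rbrakk> \<Longrightarrow>
      br x (br y z) + br y (br z x) + br z (br x y) = 0"

definition tomihisa_identity :: "'a::real_vector set \<Rightarrow> ('a \<Rightarrow> 'a \<Rightarrow> 'a) \<Rightarrow> bool" where
  "tomihisa_identity g br \<longleftrightarrow>
    (\<forall>F1\<in>g. \<forall>F2\<in>g. \<forall>F3\<in>g. \<forall>F4\<in>g. \<forall>F5\<in>g.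
      br F1 (br (br F2 F3) (br F4 F5))
    + br F3 (br (br F2 F5) (br F4 F1))
    + br F5 (br (br F2 F1) (br F4 F3)) = 0)"

text \<open>A function of two real coordinates whose first coordinate ranges over the open set \<open>A\<close>
  is represented by its extension by zero to the whole plane. This makes functions that agree on
  the chart equal, and excludes the coordinate singularities at which the brackets below would
  divide by zero.\<close>

definition on_chart :: "real set \<Rightarrow> (real \<Rightarrow> real \<Rightarrow> real) \<Rightarrow> real \<Rightarrow> real \<Rightarrow> real" where
  "on_chart A f = (\<lambda>x y. if x \<in> A then f x y else 0)"

definition partial1 :: "(real \<Rightarrow> real \<Rightarrow> real) \<Rightarrow> real \<Rightarrow> real \<Rightarrow> real" where
  "partial1 F x y = deriv (\<lambda>t. F t y) x"

definition partial2 :: "(real \<Rightarrow> real \<Rightarrow> real) \<Rightarrow> real \<Rightarrow> real \<Rightarrow> real" where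
  "partial2 F x y = deriv (\<lambda>t. F x t) y"

definition poisson ::
  "(real \<Rightarrow> real \<Rightarrow> real) \<Rightarrow> (real \<Rightarrow> real \<Rightarrow> real) \<Rightarrow> real \<Rightarrow> real \<Rightarrow> real" where
  "poisson F G x y = partial1 F x y * partial2 G x y - partial2 F x y * partial1 G x y"

text \<open>Spherical coordinates \<open>(\<theta>, \<phi>)\<close> with \<open>0 < \<theta> < pi\<close>. Here and below the angle \<open>\<phi>\<close> ranges over
  all reals, the functions being periodic in it.\<close>

definition sphere_algebra :: "(real \<Rightarrow> real \<Rightarrow> real) set" where
  "sphere_algebra = span
    {on_chart {0<..<pi} (\<lambda>\<theta> \<phi>. sin \<theta> * cos \<phi>),
     on_chart {0<..<pi} (\<lambda>\<theta> \<phi>. sin \<theta> * sin \<phi>),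
     on_chart {0<..<pi} (\<lambda>\<theta> \<phi>. cos \<theta>)}"

definition sphere_bracket ::
  "(real \<Rightarrow> real \<Rightarrow> real) \<Rightarrow> (real \<Rightarrow> real \<Rightarrow> real) \<Rightarrow> real \<Rightarrow> real \<Rightarrow> real" where
  "sphere_bracket F G = on_chart {0<..<pi} (\<lambda>\<theta> \<phi>. 1 / sin \<theta> * poisson F G \<theta> \<phi>)"

text \<open>One sheet of the two-sheeted hyperboloid, away from its pole. The coordinate written \<open>u\<close>
  here is usually called chi, a letter that the library reserves as a binder for vectors.\<close>

definition hyperboloid_minus_algebra :: "(real \<Rightarrow> real \<Rightarrow> real) set" where
  "hyperboloid_minus_algebra = span
    {on_chart {0<..} (\<lambda>u \<phi>. sinh u * cos \<phi>),
     on_chart {0<..} (\<lambda>u \<phi>. sinh u * sin \<phi>),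
     on_chart {0<..} (\<lambda>u \<phi>. cosh u)}"

definition hyperboloid_minus_bracket ::
  "(real \<Rightarrow> real \<Rightarrow> real) \<Rightarrow> (real \<Rightarrow> real \<Rightarrow> real) \<Rightarrow> real \<Rightarrow> real \<Rightarrow> real" where
  "hyperboloid_minus_bracket F G = on_chart {0<..} (\<lambda>u \<phi>. 1 / sinh u * poisson F G u \<phi>)"

text \<open>The one-sheeted hyperboloid; \<open>u\<close> ranges over all reals since \<open>cosh\<close> never vanishes.\<close>

definition hyperboloid_plus_algebra :: "(real \<Rightarrow> real \<Rightarrow> real) set" where
  "hyperboloid_plus_algebra = span
    {(\<lambda>u \<phi>. cosh u * cos \<phi>), (\<lambda>u \<phi>. cosh u * sin \<phi>), (\<lambda>u \<phi>. sinh u)}"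

definition hyperboloid_plus_bracket ::
  "(real \<Rightarrow> real \<Rightarrow> real) \<Rightarrow> (real \<Rightarrow> real \<Rightarrow> real) \<Rightarrow> real \<Rightarrow> real \<Rightarrow> real" where
  "hyperboloid_plus_bracket F G = (\<lambda>u \<phi>. 1 / cosh u * poisson F G u \<phi>)"

definition quadratic_forms :: "(real \<Rightarrow> real \<Rightarrow> real) set" where
  "quadratic_forms = {F. \<exists>a b c. F = (\<lambda>p q. a * p\<^sup>2 + b * p * q + c * q\<^sup>2)}"

end

theory Submission
  imports Defs
begin

text \<open>
  An alternating bilinear product on a three-dimensional space is the cross product followed by a
  linear map: \<open>br x y = M (x \<times> y)\<close>, where the columns of \<open>M\<close> are the brackets of the basis vectors.
  If moreover \<open>M (M u \<times> M v) = k (u \<times> v)\<close> for a constant \<open>k\<close>, then each of the three terms of the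
  Tomihisa identity is \<open>k M\<close> applied to the corresponding term for the cross product. Those sum
  to zero by vector algebra (\<open>tomihisa_cross3\<close>, \<open>tomihisa_identity_cross_bracket\<close>).

  The constant exists, with \<open>k = det M\<close>, because of the Jacobi identity. For every matrix,
  \<open>M\<^sup>T (M u \<times> M v) = det M (u \<times> v)\<close>, so the question is how far \<open>M\<close> is from its transpose. The
  difference \<open>M - M\<^sup>T\<close> is the cross product with a vector \<open>s\<close>, and the Jacobi identity for the
  basis vectors says exactly that \<open>M s = 0\<close>. Hence \<open>s\<close> is orthogonal to the image of \<open>M\<close>, so that
  \<open>s \<times> (M u \<times> M v) = 0\<close> and \<open>M\<close> acts on \<open>M u \<times> M v\<close> as \<open>M\<^sup>T\<close> does
  (\<open>matrix_cross_eq_det\<close>, \<open>jacobi_imp_matrix_cross_eq_det\<close>).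

  In each of the four Poisson algebras \<open>M\<close> is symmetric, so \<open>s = 0\<close> and nothing beyond the
  computation of \<open>M\<close> is required. The sphere and the two hyperboloids are surfaces of revolution
  with profile functions satisfying \<open>f' = h\<close> and \<open>h' = \<epsilon> f\<close>, with \<open>\<epsilon> = -1\<close> or \<open>\<epsilon> = 1\<close>. They are
  treated together in \<open>tomihisa_identity_revolution\<close>.
\<close>

unbundle cross3_syntax

section \<open>The identity for brackets obtained from the cross product\<close>

lemma tomihisa_cross3:
  fixes a b c d e :: "real^3"
  shows "a \<times> ((b \<times> c) \<times> (d \<times> e)) + c \<times> ((b \<times> e) \<times> (d \<times> a)) + e \<times> ((b \<times> a) \<times> (d \<times> c)) = 0"
  by (simp add: vec_eq_iff forall_3 cross_components algebra_simps)

text \<open>The Tomihisa sum vanishes already in \<open>\<real>\<^sup>3\<close> and \<open>\<phi>\<close> only pushes it forward, so a spanning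
  family with known brackets is enough for a concrete function space.\<close>

lemma tomihisa_identity_cross_bracket:
  fixes \<phi> :: "real^3 \<Rightarrow> 'a::real_vector" and M :: "real^3^3"
  assumes lin: "linear \<phi>"
    and bracket: "\<And>x y. br (\<phi> x) (\<phi> y) = \<phi> (M *v (x \<times> y))"
    and inverse: "\<And>u v. M *v ((M *v u) \<times> (M *v v)) = k *\<^sub>R (u \<times> v)"
  shows "tomihisa_identity (range \<phi>) br"
proof -
  let ?C = "\<lambda>a b c d e :: real^3. a \<times> ((b \<times> c) \<times> (d \<times> e))"
  have nested: "br (\<phi> a) (br (br (\<phi> b) (\<phi> c)) (br (\<phi> d) (\<phi> e))) = \<phi> (k *\<^sub>R (M *v ?C a b c d e))"
    for a b c d e
    by (simp only: bracket inverse cross_mult_right matrix_vector_mult_scaleR)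
  have "\<phi> (k *\<^sub>R (M *v ?C a b c d e)) + \<phi> (k *\<^sub>R (M *v ?C c b e d a))
      + \<phi> (k *\<^sub>R (M *v ?C e b a d c)) = 0" for a b c d e
  proof -
    have "\<phi> (k *\<^sub>R (M *v ?C a b c d e)) + \<phi> (k *\<^sub>R (M *v ?C c b e d a))
        + \<phi> (k *\<^sub>R (M *v ?C e b a d c))
      = \<phi> (k *\<^sub>R (M *v (?C a b c d e + ?C c b e d a + ?C e b a d c)))"
      by (simp add: linear_add[OF lin] matrix_vector_right_distrib scaleR_add_right)
    then show ?thesis
      by (simp add: tomihisa_cross3 linear_0[OF lin])
  qed
  then show ?thesis
    unfolding tomihisa_identity_def by (auto simp only: ball_simps nested)
qed

text \<open>For symmetric \<open>M\<close> the equation below is the cofactor identity \<open>cross_matrix_mult\<close>. The axis \<open>s\<close>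
  of the skew part contributes the error \<open>s \<times> (M u \<times> M v)\<close>, which vanishes because
  \<open>M\<^sup>T s = M s - s \<times> s = 0\<close> makes \<open>s\<close> orthogonal to \<open>M u\<close> and \<open>M v\<close>.\<close>

lemma matrix_cross_eq_det:
  fixes M :: "real^3^3"
  assumes skew: "\<And>x. M *v x = transpose M *v x + s \<times> x" and kernel: "M *v s = 0"
  shows "M *v ((M *v u) \<times> (M *v v)) = det M *\<^sub>R (u \<times> v)"
proof -
  have "transpose M *v s = 0"
    using skew[of s] kernel by simp
  then have orth: "s \<bullet> (M *v x) = 0" for x
    by (metis dot_lmul_matrix inner_zero_left transpose_matrix_vector)
  have "s \<times> ((M *v u) \<times> (M *v v)) = (s \<bullet> (M *v v)) *\<^sub>R (M *v u) - (s \<bullet> (M *v u)) *\<^sub>R (M *v v)"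
    by (rule Lagrange)
  then show ?thesis
    by (simp add: skew[of "(M *v u) \<times> (M *v v)"] cross_matrix_mult orth del: transpose_matrix_vector)
qed

text \<open>For basis vectors \<open>e\<^sub>1, e\<^sub>2, e\<^sub>3\<close> the Jacobi sum is \<open>M\<close> applied to \<open>\<Sum>i. e\<^sub>i \<times> M e\<^sub>i\<close>, and this
  vector is the axis of the skew part of \<open>M\<close>.\<close>

lemma jacobi_imp_matrix_cross_eq_det:
  fixes M :: "real^3^3"
  assumes jacobi: "\<And>x y z. M *v (x \<times> (M *v (y \<times> z))) + M *v (y \<times> (M *v (z \<times> x)))
      + M *v (z \<times> (M *v (x \<times> y))) = 0"
  shows "M *v ((M *v u) \<times> (M *v v)) = det M *\<^sub>R (u \<times> v)"
proof (rule matrix_cross_eq_det)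
  let ?e = "\<lambda>i. axis i 1 :: real^3"
  define s where "s = ?e 1 \<times> (M *v ?e 1) + ?e 2 \<times> (M *v ?e 2) + ?e 3 \<times> (M *v ?e 3)"
  show "M *v s = 0"
    using jacobi[of "?e 1" "?e 2" "?e 3"]
    by (simp add: s_def cross_basis matrix_vector_right_distrib)
  show "M *v x = transpose M *v x + s \<times> x" for x
    by (simp add: s_def vec_eq_iff forall_3 cross_components axis_def
        matrix_vector_mult_def vector_matrix_mult_def transpose_def sum_3 algebra_simps)
qed

section \<open>Coordinates on three-dimensional spaces\<close>

definition combination3 :: "'a::real_vector \<Rightarrow> 'a \<Rightarrow> 'a \<Rightarrow> real^3 \<Rightarrow> 'a" where
  "combination3 a b c x = x$1 *\<^sub>R a + x$2 *\<^sub>R b + x$3 *\<^sub>R c"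

lemma linear_combination3: "linear (combination3 a b c)"
  by (rule linearI) (simp_all add: combination3_def algebra_simps)

lemma range_combination3: "range (combination3 a b c) = span {a, b, c}"
proof
  show "range (combination3 a b c) \<subseteq> span {a, b, c}"
  proof (rule image_subsetI)
    show "combination3 a b c x \<in> span {a, b, c}" for x
      unfolding combination3_def by (intro span_add span_scale span_base) simp_all
  qed
  show "span {a, b, c} \<subseteq> range (combination3 a b c)"
  proof
    fix x assume "x \<in> span {a, b, c}"
    then obtain r s t where "x - r *\<^sub>R a - s *\<^sub>R b - t *\<^sub>R c = 0"
      by (auto simp: span_breakdown_eq)
    then have "x = combination3 a b c (vector [r, s, t])"
      by (simp add: combination3_def vector_3 algebra_simps)
    then show "x \<in> range (combination3 a b c)" by blast
  qed
qed

lemma combination3_eq_0: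
  assumes "independent {a, b, c}" "a \<noteq> b" "b \<noteq> c" "a \<noteq> c" and eq: "combination3 a b c x = 0"
  shows "x = 0"
proof -
  let ?u = "\<lambda>v. if v = a then x$1 else if v = b then x$2 else x$3"
  have "(\<Sum>v\<in>{a, b, c}. ?u v *\<^sub>R v) = 0"
    using assms(2-4) eq by (auto simp: combination3_def algebra_simps)
  then have "?u v = 0" if "v \<in> {a, b, c}" for v
    using independentD[OF assms(1), of "{a, b, c}" ?u] that by blast
  from this[of a] this[of b] this[of c] show ?thesis
    using assms(2-4) by (auto simp: vec_eq_iff forall_3)
qed

lemma alternating_bracket_combination3:
  fixes a b c :: "'a::real_vector"
  assumes left: "\<And>x y z r t. \<lbrakk>x \<in> g; y \<in> g; z \<in> g\<rbrakk> \<Longrightarrow>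
      br (r *\<^sub>R x + t *\<^sub>R y) z = r *\<^sub>R br x z + t *\<^sub>R br y z"
    and right: "\<And>x y z r t. \<lbrakk>x \<in> g; y \<in> g; z \<in> g\<rbrakk> \<Longrightarrow>
      br z (r *\<^sub>R x + t *\<^sub>R y) = r *\<^sub>R br z x + t *\<^sub>R br z y"
    and alt: "\<And>x. x \<in> g \<Longrightarrow> br x x = 0"
    and g: "subspace g" "a \<in> g" "b \<in> g" "c \<in> g"
  shows "br (combination3 a b c x) (combination3 a b c y)
    = combination3 (br b c) (br c a) (br a b) (x \<times> y)"
proof -
  \<comment> \<open>Polarisation of \<open>br (u + v) (u + v) = 0\<close>\<close>
  have skew: "br v u = - br u v" if "u \<in> g" "v \<in> g" for u v
  proof -
    have "u + v \<in> g" using that g(1) by (simp add: subspace_add)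
    then have "0 = br (1 *\<^sub>R u + 1 *\<^sub>R v) (1 *\<^sub>R u + 1 *\<^sub>R v)"
      by (simp add: alt)
    also have "\<dots> = br u v + br v u"
      using that \<open>u + v \<in> g\<close> left[of u v "u + v" 1 1] right[of u v u 1 1] right[of u v v 1 1]
      by (simp add: alt)
    finally show ?thesis by (simp add: eq_neg_iff_add_eq_0 add.commute)
  qed
  \<comment> \<open>The coefficient \<open>1\<close> gives the sum of three terms the two-term shape of the linearity rules.\<close>
  have comb: "combination3 a b c x = 1 *\<^sub>R (x$1 *\<^sub>R a + x$2 *\<^sub>R b) + x$3 *\<^sub>R c" for x
    by (simp add: combination3_def)
  have mem: "r *\<^sub>R u + t *\<^sub>R v \<in> g" if "u \<in> g" "v \<in> g" for r t u v
    using that g(1) by (simp add: subspace_add subspace_scale)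
  have L: "br (combination3 a b c x) z = x$1 *\<^sub>R br a z + x$2 *\<^sub>R br b z + x$3 *\<^sub>R br c z"
    if "z \<in> g" for z
    unfolding comb using that g by (simp only: left mem) simp
  have R: "br z (combination3 a b c y) = y$1 *\<^sub>R br z a + y$2 *\<^sub>R br z b + y$3 *\<^sub>R br z c"
    if "z \<in> g" for z
    unfolding comb using that g by (simp only: right mem) simp
  have "combination3 a b c y \<in> g"
    unfolding comb using g by (intro mem)
  then show ?thesis
    by (simp add: L R g alt skew[OF g(2,3)] skew[OF g(4,2)] skew[OF g(3,4)]
        combination3_def[of "br b c"] cross_components algebra_simps)
qed

theorem tomihisa_identity_dim_3:
  fixes g :: "'a::real_vector set"
  assumes "real_lie_algebra g br" and "dim g = 3"
  shows "tomihisa_identity g br"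
proof -
  interpret real_lie_algebra g br by fact
  obtain B where B: "B \<subseteq> g" "independent B" "g \<subseteq> span B" "card B = 3"
    using basis_exists[of g] \<open>dim g = 3\<close> by metis
  then obtain a b c where abc: "B = {a, b, c}" "a \<noteq> b" "b \<noteq> c" "a \<noteq> c"
    by (auto simp: card_3_iff)
  define \<phi> where "\<phi> = combination3 a b c"
  have lin: "linear \<phi>" by (simp add: \<phi>_def linear_combination3)
  have range: "range \<phi> = g"
    unfolding \<phi>_def range_combination3 using B abc(1) subspace
    by (metis span_minimal subset_antisym)
  have in_g: "a \<in> g" "b \<in> g" "c \<in> g" using B(1) abc(1) by auto
  obtain m1 m2 m3 where m: "br b c = \<phi> m1" "br c a = \<phi> m2" "br a b = \<phi> m3"
    using closed in_g unfolding range[symmetric] by (metis imageE)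
  define M :: "real^3^3" where "M = transpose (vector [m1, m2, m3])"
  have M: "M *v w = w$1 *\<^sub>R m1 + w$2 *\<^sub>R m2 + w$3 *\<^sub>R m3" for w
    by (simp add: M_def vec_eq_iff matrix_vector_mult_def transpose_def sum_3 vector_3)
  have bracket: "br (\<phi> x) (\<phi> y) = \<phi> (M *v (x \<times> y))" for x y
  proof -
    have "br (\<phi> x) (\<phi> y) = combination3 (\<phi> m1) (\<phi> m2) (\<phi> m3) (x \<times> y)"
      unfolding m[symmetric] unfolding \<phi>_def
      using alternating_bracket_combination3[of g br a b c x y,
          OF linear_left linear_right alternating subspace in_g] by blast
    also have "\<dots> = \<phi> (M *v (x \<times> y))"
      by (simp add: M combination3_def linear_add[OF lin] linear_scale[OF lin])
    finally show ?thesis .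
  qed
  have "M *v (x \<times> (M *v (y \<times> z))) + M *v (y \<times> (M *v (z \<times> x)))
      + M *v (z \<times> (M *v (x \<times> y))) = 0" for x y z
  proof -
    have "\<phi> (M *v (x \<times> (M *v (y \<times> z))) + M *v (y \<times> (M *v (z \<times> x)))
      + M *v (z \<times> (M *v (x \<times> y)))) = 0"
      using jacobi[of "\<phi> x" "\<phi> y" "\<phi> z"] range by (auto simp: bracket linear_add[OF lin])
    then show ?thesis
      using combination3_eq_0 B(2) abc unfolding \<phi>_def by blast
  qed
  then have "M *v ((M *v u) \<times> (M *v v)) = det M *\<^sub>R (u \<times> v)" for u v
    by (rule jacobi_imp_matrix_cross_eq_det)
  from tomihisa_identity_cross_bracket[OF lin bracket this] range show ?thesis
    by simp
qed

section \<open>The four Poisson algebras\<close>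

text \<open>Here the cofactor identity applies directly, which replaces the argument from the Jacobi
  identity for the concrete algebras.\<close>

lemma tomihisa_identity_symmetric_cross_bracket:
  fixes M :: "real^3^3"
  assumes "transpose M = M"
    and "\<And>x y. br (combination3 a b c x) (combination3 a b c y) = combination3 a b c (M *v (x \<times> y))"
  shows "tomihisa_identity (span {a, b, c}) br"
  unfolding range_combination3[symmetric]
proof (rule tomihisa_identity_cross_bracket[OF linear_combination3 assms(2)])
  show "M *v ((M *v u) \<times> (M *v v)) = det M *\<^sub>R (u \<times> v)" for u v
    using cross_matrix_mult[of M u v] assms(1) by simp
qed

lemma combination3_apply:
  "combination3 F G H x s t = x$1 * F s t + x$2 * G s t + x$3 * H s t"
  for F G H :: "real \<Rightarrow> real \<Rightarrow> real"
  by (simp add: combination3_def plus_fun_def scaleR_fun_def)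

text \<open>A function cut off outside an open set has the same derivatives inside it.\<close>

lemma partial1_eqI:
  assumes "open A" "s \<in> A" and eq: "\<And>r. r \<in> A \<Longrightarrow> F r t = f r" and "(f has_real_derivative D) (at s)"
  shows "partial1 F s t = D"
proof -
  have "((\<lambda>r. F r t) has_real_derivative D) (at s)"
    using has_field_derivative_transform_within_open[OF assms(4,1,2)] eq by metis
  then show ?thesis by (simp add: partial1_def DERIV_imp_deriv)
qed

lemma partial2_eqI:
  assumes "((\<lambda>r. F s r) has_real_derivative D) (at t)"
  shows "partial2 F s t = D"
  using assms by (simp add: partial2_def DERIV_imp_deriv)

text \<open>With \<open>X = f cos t\<close>, \<open>Y = f sin t\<close> and \<open>Z = h\<close> the bracket gives \<open>{X, Y} = Z\<close>,
  \<open>{Y, Z} = -\<epsilon> X\<close> and \<open>{Z, X} = -\<epsilon> Y\<close>, hence the diagonal matrix \<open>(-\<epsilon>, -\<epsilon>, 1)\<close>.\<close>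

lemma tomihisa_identity_revolution:
  fixes f h :: "real \<Rightarrow> real"
  assumes "open A"
    and f: "\<And>s. s \<in> A \<Longrightarrow> (f has_real_derivative h s) (at s)"
    and h: "\<And>s. s \<in> A \<Longrightarrow> (h has_real_derivative \<epsilon> * f s) (at s)"
    and nz: "\<And>s. s \<in> A \<Longrightarrow> f s \<noteq> 0"
  shows "tomihisa_identity
    (span {on_chart A (\<lambda>s t. f s * cos t), on_chart A (\<lambda>s t. f s * sin t), on_chart A (\<lambda>s t. h s)})
    (\<lambda>F G. on_chart A (\<lambda>s t. 1 / f s * poisson F G s t))"
proof -
  define \<phi> where "\<phi> = combination3 (on_chart A (\<lambda>s t. f s * cos t))
      (on_chart A (\<lambda>s t. f s * sin t)) (on_chart A (\<lambda>s t. h s))"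
  have val: "\<phi> x s t = (if s \<in> A then x$1 * (f s * cos t) + x$2 * (f s * sin t) + x$3 * h s else 0)"
    for x s t
    by (simp add: \<phi>_def combination3_apply on_chart_def)
  have p1: "partial1 (\<phi> x) s t = x$1 * (h s * cos t) + x$2 * (h s * sin t) + x$3 * (\<epsilon> * f s)"
    if "s \<in> A" for x s t
    by (rule partial1_eqI[OF assms(1) that,
          where f = "\<lambda>r. x$1 * (f r * cos t) + x$2 * (f r * sin t) + x$3 * h r"])
      (auto simp: val intro!: derivative_eq_intros f h that)
  have p2: "partial2 (\<phi> x) s t = x$2 * (f s * cos t) - x$1 * (f s * sin t)" if "s \<in> A" for x s t
    by (rule partial2_eqI) (auto simp: val that intro!: derivative_eq_intros)
  define M :: "real^3^3" where "M = vector [vector [-\<epsilon>, 0, 0], vector [0, -\<epsilon>, 0], vector [0, 0, 1]]"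
  have M: "(M *v w)$1 = -\<epsilon> * w$1" "(M *v w)$2 = -\<epsilon> * w$2" "(M *v w)$3 = w$3" for w
    by (simp_all add: M_def matrix_vector_mult_def sum_3 vector_3)
  have "transpose M = M"
    by (simp add: M_def transpose_def vec_eq_iff forall_3 vector_3)
  moreover have "on_chart A (\<lambda>s t. 1 / f s * poisson (\<phi> x) (\<phi> y) s t) = \<phi> (M *v (x \<times> y))" for x y
  proof (intro ext)
    fix s t
    show "on_chart A (\<lambda>s t. 1 / f s * poisson (\<phi> x) (\<phi> y) s t) s t = \<phi> (M *v (x \<times> y)) s t"
    proof (cases "s \<in> A")
      case True
      \<comment> \<open>The angular identity is applied only to the last term, where \<open>f h\<close> is multiplied by
        \<open>(cos t)\<^sup>2 + (sin t)\<^sup>2\<close>; the rest is an identity of polynomials.\<close>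
      have "poisson (\<phi> x) (\<phi> y) s t = f s * (- \<epsilon> * (x \<times> y)$1 * (f s * cos t)
          - \<epsilon> * (x \<times> y)$2 * (f s * sin t) + (x \<times> y)$3 * h s * ((cos t)\<^sup>2 + (sin t)\<^sup>2))"
        unfolding poisson_def p1[OF True] p2[OF True] cross_components by algebra
      with True nz show ?thesis
        by (simp add: on_chart_def val M)
    qed (simp add: on_chart_def val)
  qed
  ultimately show ?thesis
    unfolding \<phi>_def by (rule tomihisa_identity_symmetric_cross_bracket)
qed

lemma quadratic_forms_eq_span:
  "quadratic_forms = span {\<lambda>p q. p\<^sup>2, \<lambda>p q. p * q, \<lambda>p q. q\<^sup>2}"
proof -
  let ?\<phi> = "combination3 (\<lambda>p q. p\<^sup>2) (\<lambda>p q. p * q) (\<lambda>p q. q\<^sup>2) :: real^3 \<Rightarrow> real \<Rightarrow> real \<Rightarrow> real"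
  have "(\<lambda>p q. a * p\<^sup>2 + b * p * q + c * q\<^sup>2) = ?\<phi> (vector [a, b, c])" for a b c
    by (simp add: fun_eq_iff combination3_apply vector_3)
  moreover have "?\<phi> x = (\<lambda>p q. x$1 * p\<^sup>2 + x$2 * p * q + x$3 * q\<^sup>2)" for x
    by (simp add: fun_eq_iff combination3_apply)
  ultimately show ?thesis
    unfolding range_combination3[symmetric] quadratic_forms_def by blast
qed

text \<open>The matrix comes from \<open>{pq, q\<^sup>2} = 2q\<^sup>2\<close>, \<open>{q\<^sup>2, p\<^sup>2} = -4pq\<close> and \<open>{p\<^sup>2, pq} = 2p\<^sup>2\<close>.\<close>

lemma tomihisa_identity_quadratic_forms: "tomihisa_identity quadratic_forms poisson"
proof -
  define \<phi> :: "real^3 \<Rightarrow> real \<Rightarrow> real \<Rightarrow> real"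
    where "\<phi> = combination3 (\<lambda>p q. p\<^sup>2) (\<lambda>p q. p * q) (\<lambda>p q. q\<^sup>2)"
  have val: "\<phi> x p q = x$1 * p\<^sup>2 + x$2 * (p * q) + x$3 * q\<^sup>2" for x p q
    by (simp add: \<phi>_def combination3_apply)
  have p1: "partial1 (\<phi> x) p q = 2 * x$1 * p + x$2 * q" for x p q
    by (rule partial1_eqI[OF open_UNIV UNIV_I, where f = "\<lambda>r. x$1 * r\<^sup>2 + x$2 * (r * q) + x$3 * q\<^sup>2"])
      (auto simp: val intro!: derivative_eq_intros)
  have p2: "partial2 (\<phi> x) p q = x$2 * p + 2 * x$3 * q" for x p q
    by (rule partial2_eqI) (auto simp: val intro!: derivative_eq_intros)
  define M :: "real^3^3" where "M = vector [vector [0, 0, 2], vector [0, -4, 0], vector [2, 0, 0]]"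
  have M: "(M *v w)$1 = 2 * w$3" "(M *v w)$2 = -4 * w$2" "(M *v w)$3 = 2 * w$1" for w
    by (simp_all add: M_def matrix_vector_mult_def sum_3 vector_3)
  have "transpose M = M"
    by (simp add: M_def transpose_def vec_eq_iff forall_3 vector_3)
  moreover have "poisson (\<phi> x) (\<phi> y) = \<phi> (M *v (x \<times> y))" for x y
    unfolding fun_eq_iff poisson_def p1 p2 val M cross_components
    by (simp add: algebra_simps power2_eq_square)
  ultimately show ?thesis
    unfolding \<phi>_def quadratic_forms_eq_span by (rule tomihisa_identity_symmetric_cross_bracket)
qed

lemma tomihisa_identity_sphere: "tomihisa_identity sphere_algebra sphere_bracket"
  unfolding sphere_algebra_def sphere_bracket_def[abs_def]
  by (rule tomihisa_identity_revolution[where \<epsilon> = "-1"])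
    (auto intro!: derivative_eq_intros dest: sin_gt_zero)

lemma tomihisa_identity_hyperboloid_minus:
  "tomihisa_identity hyperboloid_minus_algebra hyperboloid_minus_bracket"
  unfolding hyperboloid_minus_algebra_def hyperboloid_minus_bracket_def[abs_def]
  by (rule tomihisa_identity_revolution[where \<epsilon> = 1]) (auto intro!: derivative_eq_intros)

lemma tomihisa_identity_hyperboloid_plus:
  "tomihisa_identity hyperboloid_plus_algebra hyperboloid_plus_bracket"
proof -
  have [simp]: "on_chart UNIV F = F" for F
    by (simp add: on_chart_def)
  have "hyperboloid_plus_bracket = (\<lambda>F G. on_chart UNIV (\<lambda>s t. 1 / cosh s * poisson F G s t))"
    by (simp add: fun_eq_iff hyperboloid_plus_bracket_def)
  moreover have "tomihisa_identity
    (span {on_chart UNIV (\<lambda>s t. cosh s * cos t), on_chart UNIV (\<lambda>s t. cosh s * sin t),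
      on_chart UNIV (\<lambda>s t. sinh s)})
    (\<lambda>F G. on_chart UNIV (\<lambda>s t. 1 / cosh s * poisson F G s t))"
    by (rule tomihisa_identity_revolution[where \<epsilon> = 1]) (auto intro!: derivative_eq_intros)
  ultimately show ?thesis
    unfolding hyperboloid_plus_algebra_def by simp
qed

theorem mainTheorem17:
  shows "(\<forall>(g :: 'a::real_vector set) br.
            real_lie_algebra g br \<and> dim g = 3 \<longrightarrow> tomihisa_identity g br)
       \<and> tomihisa_identity sphere_algebra sphere_bracket
       \<and> tomihisa_identity hyperboloid_minus_algebra hyperboloid_minus_bracket
       \<and> tomihisa_identity hyperboloid_plus_algebra hyperboloid_plus_bracket
       \<and> tomihisa_identity quadratic_forms poisson"
  using tomihisa_identity_dim_3 tomihisa_identity_sphere tomihisa_identity_hyperboloid_minus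
    tomihisa_identity_hyperboloid_plus tomihisa_identity_quadratic_forms
  by blast

end
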